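(* Let $\mathcal S=(n,I,J,K,\psi,\pi)$ be a system and let $(y_i)_{i=0}^n$ be the sequence generated by $\mathcal S$. Then $y_n\le F(n+1)$.
   Context: The Fibonacci numbers are defined by $F(0)=F(1)=1$, $F(m+1)=F(m)+F(m-1)$. A system is a tuple $\mathcal S=(n,I,J,K,\psi,\pi)$ where $n\ge2$ is an integer, $I,J,K$ are pairwise disjoint subsets of $\{2,\dots,n\}$ with $|I|=|J|\ge|K|$, $\psi:I\to J$ is a bijection, $\pi:I\to K$ is a surjection, and $i<\pi(i)<\psi(i)$ for all $i\in I$. Indices in $I$, $J$, $K$ are called exceptional, penalty and fine respectively; indices in $\{2,\dots,n\}$ in none of them are ordinary. For $k\in K$ put $d(k)=\min\pi^{-1}(k)$. For $2\le r\le n$ let $\theta(r)=r-2$ if $r$ is ordinary, $r-1$ if $r$ is exceptional, $\psi^{-1}(r)-1$ if $r$ is penalty, and $d(r)-2$ if $r$ is fine. The sequence generated by $\mathcal S$ is the sequence $(y_i)_{i=0}^n$ with $y_0=1$, $y_1=2$ and $y_r=y_{r-1}+y_{\theta(r)}$ for $2\le r\le n$. *)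

theory Defs
  imports "HOL-Number_Theory.Fib"
begin

text \<open>
  The Fibonacci numbers are normalised by \<open>F 0 = F 1 = 1\<close>, whereas the library function
  \<^const>\<open>fib\<close> starts with \<open>fib 0 = 0\<close>, \<open>fib 1 = 1\<close>; hence the shift.
\<close>

definition F :: "nat \<Rightarrow> nat" where
  "F m = fib (m + 1)"

lemma F_0: "F 0 = 1"
  and F_1: "F 1 = 1"
  and F_rec: "1 \<le> m \<Longrightarrow> F (m + 1) = F m + F (m - 1)"
  by (cases m; simp add: F_def)+

text \<open>
  The maps \<open>\<psi>\<close> and \<open>\<pi>\<close> are total functions on \<^typ>\<open>nat\<close>, of which only the restrictions to \<open>I\<close>
  matter.
\<close>

definition is_system ::
  "nat \<Rightarrow> nat set \<Rightarrow> nat set \<Rightarrow> nat set \<Rightarrow> (nat \<Rightarrow> nat) \<Rightarrow> (nat \<Rightarrow> nat) \<Rightarrow> bool" where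
  "is_system n I J K \<psi> \<pi> \<longleftrightarrow>
     2 \<le> n \<and>
     I \<subseteq> {2..n} \<and> J \<subseteq> {2..n} \<and> K \<subseteq> {2..n} \<and>
     I \<inter> J = {} \<and> I \<inter> K = {} \<and> J \<inter> K = {} \<and>
     card I = card J \<and> card K \<le> card J \<and>
     bij_betw \<psi> I J \<and> \<pi> ` I = K \<and>
     (\<forall>i\<in>I. i < \<pi> i \<and> \<pi> i < \<psi> i)"

definition d :: "nat set \<Rightarrow> (nat \<Rightarrow> nat) \<Rightarrow> nat \<Rightarrow> nat" where
  "d I \<pi> k = Min {i \<in> I. \<pi> i = k}"

text \<open>
  Only used for \<open>2 \<le> r \<le> n\<close>; in a system the natural-number subtractions then do not truncate,
  because \<open>I\<close>, and with it every value of \<open>\<psi>\<^sup>-\<^sup>1\<close> and of \<open>d\<close>, lies in \<open>{2..n}\<close>.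
\<close>

definition theta ::
  "nat set \<Rightarrow> nat set \<Rightarrow> nat set \<Rightarrow> (nat \<Rightarrow> nat) \<Rightarrow> (nat \<Rightarrow> nat) \<Rightarrow> nat \<Rightarrow> nat" where
  "theta I J K \<psi> \<pi> r =
     (if r \<in> I then r - 1
      else if r \<in> J then inv_into I \<psi> r - 1
      else if r \<in> K then d I \<pi> r - 2
      else r - 2)"

text \<open>
  A finite sequence \<open>(y\<^sub>i)\<close> with \<open>0 \<le> i \<le> n\<close> is represented by a function on \<^typ>\<open>nat\<close> whose values
  beyond \<open>n\<close> are irrelevant.
\<close>

definition is_generated_by ::
  "(nat \<Rightarrow> nat) \<Rightarrow> nat \<Rightarrow> nat set \<Rightarrow> nat set \<Rightarrow> nat set \<Rightarrow> (nat \<Rightarrow> nat) \<Rightarrow> (nat \<Rightarrow> nat) \<Rightarrow> bool" where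
  "is_generated_by y n I J K \<psi> \<pi> \<longleftrightarrow>
     y 0 = 1 \<and> y 1 = 2 \<and>
     (\<forall>r\<in>{2..n}. y r = y (r - 1) + y (theta I J K \<psi> \<pi> r))"

lemma theta_less:
  assumes S: "is_system n I J K \<psi> \<pi>" and r: "r \<in> {2..n}"
  shows "theta I J K \<psi> \<pi> r < r"
proof -
  have I: "I \<subseteq> {2..n}" and bij: "bij_betw \<psi> I J" and K: "\<pi> ` I = K"
    and less: "\<And>i. i \<in> I \<Longrightarrow> i < \<pi> i \<and> \<pi> i < \<psi> i"
    using S by (auto simp: is_system_def)
  have pen: "inv_into I \<psi> r < r" if "r \<in> J"
  proof -
    have "inv_into I \<psi> r \<in> I" "\<psi> (inv_into I \<psi> r) = r"
      using that bij by (auto simp: bij_betw_def inv_into_into f_inv_into_f)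
    then show ?thesis using less by fastforce
  qed
  have fine: "d I \<pi> r < r" if "r \<in> K"
  proof -
    have "finite {i \<in> I. \<pi> i = r}" "{i \<in> I. \<pi> i = r} \<noteq> {}"
      using that K finite_subset[OF I] by auto
    from Min_in[OF this] have "d I \<pi> r \<in> I" "\<pi> (d I \<pi> r) = r"
      by (simp_all add: d_def)
    then show ?thesis using less by fastforce
  qed
  show ?thesis using r pen fine by (auto simp: theta_def)
qed

lemma generated_sequence_exists:
  assumes S: "is_system n I J K \<psi> \<pi>"
  shows "\<exists>y. is_generated_by y n I J K \<psi> \<pi>"
proof -
  let ?t = "theta I J K \<psi> \<pi>"
  have "m \<le> n \<Longrightarrow> \<exists>y. is_generated_by y m I J K \<psi> \<pi>" for m
  proof (induction m)
    case 0
    show ?case by (rule exI[of _ Suc]) (simp add: is_generated_by_def)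
  next
    case (Suc m)
    then obtain y where y: "is_generated_by y m I J K \<psi> \<pi>" by auto
    show ?case
    proof (cases "m = 0")
      case True
      then show ?thesis using y by (auto simp: is_generated_by_def)
    next
      case False
      define z where "z = y(Suc m := y m + y (?t (Suc m)))"
      have old: "z i = y i" if "i < Suc m" for i
        using that by (simp add: z_def)
      have "z r = z (r - 1) + z (?t r)" if r: "r \<in> {2..Suc m}" for r
      proof -
        have "?t r < r" using theta_less[OF S, of r] r Suc.prems by simp
        then have "z (?t r) = y (?t r)" "z (r - 1) = y (r - 1)"
          using r old[of "?t r"] old[of "r - 1"] by auto
        moreover have "z r = y (r - 1) + y (?t r)"
        proof (cases "r = Suc m")
          case True
          then show ?thesis by (simp add: z_def)
        next
          case False
          then have "r \<in> {2..m}" using r by simp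
          then show ?thesis using y old[of r] by (simp add: is_generated_by_def)
        qed
        ultimately show ?thesis by simp
      qed
      moreover have "z 0 = 1" "z 1 = 2"
        using y False old[of 0] old[of 1] by (simp_all add: is_generated_by_def)
      ultimately show ?thesis unfolding is_generated_by_def by blast
    qed
  qed
  then show ?thesis by blast
qed

end

theory Submission
  imports Defs
begin

text \<open>
  A potential argument along \<open>r = min I, \<dots>, n\<close>. At time \<open>r\<close> some exceptional indices still await
  their penalty and some fines their payment; the summands that these later steps will add are
  already known and form a debt. With the golden ratio \<open>\<phi>\<close>, the sequence plus half the debt stays
  below a multiple of \<open>\<phi>\<^sup>r\<close>, inflated by one constant factor for each pending step, and
  the same holds at one power of \<open>\<phi>\<close> higher after one imagined ordinary step; the second inequality
  is what makes the first survive ordinary steps. When nothing is pending the bound reads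
  \<open>y\<^sub>n \<le> 23/20 \<phi>\<^sup>n\<close>, which is at most \<open>F (n + 1)\<close> as soon as \<open>n \<ge> 4\<close>.
\<close>

section \<open>The golden ratio and numerical estimates\<close>

definition \<phi> :: real where
  "\<phi> = (1 + sqrt 5) / 2"

lemma phi_sq: "\<phi> * \<phi> = \<phi> + 1"
proof -
  have "sqrt 5 * sqrt 5 = (5::real)" by simp
  then show ?thesis by (simp add: \<phi>_def field_simps)
qed

lemma phi_gt: "\<phi> > 1618 / 1000"
proof -
  have "sqrt 5 > (2236 / 1000 :: real)" by (rule real_less_rsqrt) (simp add: power2_eq_square)
  then show ?thesis by (simp add: \<phi>_def)
qed

lemma phi_lt: "\<phi> < 16181 / 10000"
proof -
  have "sqrt 5 < (22362 / 10000 :: real)" by (rule real_less_lsqrt) (simp_all add: power2_eq_square)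
  then show ?thesis by (simp add: \<phi>_def)
qed

lemma phi_pos: "\<phi> > 0"
  using phi_gt by simp

lemma phi_mult_left: "\<phi> * (\<phi> * x) = \<phi> * x + x"
  using phi_sq by (metis distrib_right mult.assoc mult_1)

text \<open>Both sides obey the Fibonacci recurrence, so two consecutive exponents decide.\<close>

lemma phi_power_le_F:
  "23 / 20 * \<phi> ^ (m + 4) \<le> real (F (m + 5))"
proof (induction m rule: fib.induct)
  case 1
  have "\<phi> ^ 4 = 3 * \<phi> + 2"
    by (simp add: eval_nat_numeral algebra_simps phi_mult_left phi_sq)
  moreover have "F 5 = 8" by (simp add: F_def eval_nat_numeral)
  ultimately show ?case using phi_lt by simp
next
  case 2
  have "\<phi> ^ 5 = 5 * \<phi> + 3"
    by (simp add: eval_nat_numeral algebra_simps phi_mult_left phi_sq)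
  moreover have "F 6 = 13" by (simp add: F_def eval_nat_numeral)
  ultimately show ?case using phi_lt by simp
next
  case (3 m)
  have "\<phi> ^ (Suc (Suc m) + 4) = \<phi> ^ (Suc m + 4) + \<phi> ^ (m + 4)"
    by (simp only: add_Suc power_Suc phi_mult_left)
  moreover have "F (Suc (Suc m) + 5) = F (Suc m + 5) + F (m + 5)"
    by (simp only: F_def add_Suc fib.simps)
  ultimately show ?case using 3 by simp
qed

text \<open>
  The two sides of the invariant at the first exceptional index \<open>m + 2\<close>, where \<open>1403/500\<close> is
  \<open>23/20 \<cdot> 2 \<cdot> 61/50\<close>.
\<close>

lemma F_le_phi_power:
  "2 * real (F (m + 2)) + real (F (m + 1)) / 2 \<le> 1403 / 500 * \<phi> ^ (m + 1) \<and>
   3 * real (F (m + 2)) + real (F (m + 1)) / 2 \<le> 1403 / 500 * \<phi> ^ (m + 2)"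
proof (induction m rule: fib.induct)
  case 1
  have "F 2 = 2" "F (Suc 0) = 1" by (simp_all add: F_def eval_nat_numeral)
  then show ?case using phi_gt by (simp add: eval_nat_numeral phi_sq)
next
  case 2
  have "F 3 = 3" "F 2 = 2" by (simp_all add: F_def eval_nat_numeral)
  then show ?case using phi_gt
    by (simp add: eval_nat_numeral algebra_simps phi_mult_left phi_sq)
next
  case (3 m)
  have "\<phi> ^ (Suc (Suc m) + l) = \<phi> ^ (Suc m + l) + \<phi> ^ (m + l)" for l
    by (simp only: add_Suc power_Suc phi_mult_left)
  moreover have "F (Suc (Suc m) + l) = F (Suc m + l) + F (m + l)" for l
    by (simp only: F_def add_Suc fib.simps)
  ultimately show ?case using 3 by (simp only: of_nat_add) argo
qed

text \<open>
  A fine \<open>f\<close> is paid whose \<open>m\<close> exceptional indices contribute \<open>S\<close> to the debt from then on. Each of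
  them moves from the factor \<open>2 / \<phi>\<close> to \<open>\<phi>\<^sup>2 / 2\<close>, a gain of \<open>\<phi>\<^sup>3 / 4 > 1\<close>, without which the factor
  \<open>61 / 50\<close> released by the fine could not pay for \<open>S\<close>.
\<close>

lemma fine_step_bound:
  fixes q f S Y P :: real and m :: nat
  assumes f: "0 \<le> f" "f \<le> (1 / 2) ^ m * q" and S: "S \<le> (1 - (1 / 2) ^ m) * q"
    and Y: "q + f / 2 \<le> Y" "Y \<le> P" and m: "0 < m"
  shows "Y + f / 2 + S / 2 \<le> 50 / 61 * \<phi> * (\<phi> ^ 3 / 4) ^ m * P"
    and "Y + f / 2 + S / 2 + q \<le> \<phi> * (50 / 61 * \<phi> * (\<phi> ^ 3 / 4) ^ m * P)"
proof -
  define u where "u = 50 / 61 * \<phi> * (\<phi> ^ 3 / 4) ^ m"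
  have "0 \<le> (1 / 2) ^ m * q" using f by linarith
  then have q: "0 \<le> q" using mult_le_cancel_left_pos[of "(1 / 2) ^ m" 0 q] by simp
  have tau: "\<phi> ^ 3 / 4 \<ge> 1059 / 1000"
    using phi_gt by (simp add: eval_nat_numeral algebra_simps phi_mult_left phi_sq)
  \<comment> \<open>Since \<open>\<phi> ^ 3 / 4 > 1\<close>, a lower bound at exponent
    \<open>j\<close> serves for every \<open>m \<ge> j\<close>.\<close>
  have u: "u \<ge> 50 / 61 * (1618 / 1000) * x" if "(1059 / 1000) ^ j \<ge> x" "j \<le> m" "x \<ge> 0" for x j
  proof -
    have "x \<le> (1059 / 1000) ^ m"
      using that power_increasing[of j m "1059 / 1000 :: real"] by linarith
    also have "\<dots> \<le> (\<phi> ^ 3 / 4) ^ m"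
      using tau by (intro power_mono) auto
    finally show ?thesis
      unfolding u_def using phi_gt that by (intro mult_mono) auto
  qed
  have "Y + f / 2 + S / 2 \<le> u * Y \<and> Y + f / 2 + S / 2 + q \<le> 1618 / 1000 * u * Y"
  proof -
    \<comment> \<open>\<open>v\<close> is a rational lower bound for \<open>u\<close>, and
      \<open>s\<close>, \<open>t\<close> bound \<open>f\<close>, \<open>S\<close> in units of
      \<open>q\<close>; from \<open>m = 3\<close> on one triple suffices.\<close>
    consider "m = 1" | "m = 2" | "m \<ge> 3" using m by linarith
    then obtain v s t where v: "v \<le> u" "1 \<le> v" and s: "f \<le> s * q" and t: "S \<le> t * q"
      and "v = 14044/10000 \<and> s = 1/2 \<and> t = 1/2 \<or> v = 14867/10000 \<and> s = 1/4 \<and> t = 3/4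
           \<or> v = 15740/10000 \<and> s = 1/8 \<and> t = 1"
    proof cases
      case 1
      then show ?thesis
        using that[of "14044/10000" "1/2" "1/2"] u[of "1059/1000" 1] f S by simp
    next
      case 2
      then show ?thesis
        using that[of "14867/10000" "1/4" "3/4"] u[of "1121/1000" 2] f S
        by (simp add: power2_eq_square)
    next
      case 3
      have "(1 / 2) ^ m * q \<le> (1 / 2) ^ 3 * q"
        using 3 q by (intro mult_right_mono power_decreasing) auto
      moreover have "(1 - (1 / 2) ^ m) * q \<le> 1 * q"
        using q by (intro mult_right_mono) auto
      ultimately show ?thesis
        using that[of "15740/10000" "1/8" "1"] u[of "1187/1000" 3] f S 3
        by (simp add: power3_eq_cube)
    qed
    \<comment> \<open>For \<open>m = 1\<close> the estimate \<open>q \<le> Y\<close> alone would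
      fail; the half of \<open>f\<close> contained in \<open>Y\<close> closes the gap.\<close>
    then have "Y + f / 2 + S / 2 \<le> v * Y \<and> Y + f / 2 + S / 2 + q \<le> 1618 / 1000 * (v * Y)"
      using q f Y s t by (elim disjE conjE; hypsubst; intro conjI; linarith)
    moreover have "v * Y \<le> u * Y" using v q f Y by (intro mult_right_mono) auto
    ultimately show ?thesis by auto
  qed
  moreover have "u * Y \<le> u * P" using u[of 1 0] Y by (intro mult_left_mono) auto
  moreover have "1618 / 1000 * (u * P) \<le> \<phi> * (u * P)"
    using phi_gt u[of 1 0] Y q f by (intro mult_right_mono) auto
  ultimately show "Y + f / 2 + S / 2 \<le> 50 / 61 * \<phi> * (\<phi> ^ 3 / 4) ^ m * P"
    "Y + f / 2 + S / 2 + q \<le> \<phi> * (50 / 61 * \<phi> * (\<phi> ^ 3 / 4) ^ m * P)"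
    unfolding u_def[symmetric] by auto
qed

section \<open>Elementary properties of a system and its sequence\<close>

locale generated_system =
  fixes n :: nat and I J K :: "nat set" and \<psi> \<pi> y :: "nat \<Rightarrow> nat"
  assumes system: "is_system n I J K \<psi> \<pi>"
    and generated: "is_generated_by y n I J K \<psi> \<pi>"
begin

abbreviation "\<theta> \<equiv> theta I J K \<psi> \<pi>"
abbreviation "\<delta> \<equiv> d I \<pi>"

lemma subsets: "I \<subseteq> {2..n}" "J \<subseteq> {2..n}" "K \<subseteq> {2..n}"
  and disjoint: "I \<inter> J = {}" "I \<inter> K = {}" "J \<inter> K = {}"
  and bij: "bij_betw \<psi> I J" and image: "\<pi> ` I = K"
  using system by (auto simp: is_system_def)

lemma pi_in: "i \<in> I \<Longrightarrow> \<pi> i \<in> K" and psi_in: "i \<in> I \<Longrightarrow> \<psi> i \<in> J"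
  using image bij by (auto simp: bij_betw_def)

lemma penalty_of:
  assumes "j \<in> J"
  obtains i where "i \<in> I" "j = \<psi> i"
proof -
  have "j \<in> \<psi> ` I" using assms bij by (simp add: bij_betw_def)
  then show ?thesis using that by blast
qed

lemma less: "i \<in> I \<Longrightarrow> i < \<pi> i" "i \<in> I \<Longrightarrow> \<pi> i < \<psi> i"
  using system by (auto simp: is_system_def)

lemma finite [simp]: "finite I" "finite J" "finite K"
  using subsets by (auto intro: finite_subset)

lemma delta:
  assumes "k \<in> K"
  shows "\<delta> k \<in> I" "\<pi> (\<delta> k) = k"
proof -
  have "{i \<in> I. \<pi> i = k} \<noteq> {}" using assms image by auto
  from Min_in[OF _ this] show "\<delta> k \<in> I" "\<pi> (\<delta> k) = k"
    by (simp_all add: d_def)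
qed

lemma delta_le: "i \<in> I \<Longrightarrow> \<delta> (\<pi> i) \<le> i"
  by (simp add: d_def)

lemma y_0: "y 0 = 1" and y_1: "y 1 = 2"
  and y_rec: "2 \<le> r \<Longrightarrow> r \<le> n \<Longrightarrow> y r = y (r - 1) + y (\<theta> r)"
  using generated by (auto simp: is_generated_by_def)

lemma y_mono: "l \<le> t \<Longrightarrow> t \<le> n \<Longrightarrow> y l \<le> y t"
proof (induction t)
  case (Suc t)
  have "y t \<le> y (Suc t)"
    using y_0 y_1 y_rec[of "Suc t"] Suc.prems by (cases "t = 0") auto
  then show ?case using Suc by (cases "l = Suc t") auto
qed simp

lemma y_exceptional: "i \<in> I \<Longrightarrow> y i = 2 * y (i - 1)"
  using y_rec[of i] subsets by (auto simp: theta_def)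

lemma y_fine:
  assumes "k \<in> K"
  shows "y k = y (k - 1) + y (\<delta> k - 2)"
proof -
  have "k \<notin> I" "k \<notin> J" "2 \<le> k" "k \<le> n" using assms subsets disjoint by auto
  then show ?thesis using y_rec[of k] assms by (simp add: theta_def)
qed

lemma y_penalty:
  assumes "i \<in> I"
  shows "y (\<psi> i) = y (\<psi> i - 1) + y (i - 1)"
proof -
  have "inv_into I \<psi> (\<psi> i) = i"
    using assms bij by (simp add: bij_betw_def)
  moreover have "\<psi> i \<in> J" "\<psi> i \<notin> I" "2 \<le> \<psi> i" "\<psi> i \<le> n"
    using psi_in[OF assms] subsets disjoint by auto
  ultimately show ?thesis
    using y_rec[of "\<psi> i"] by (simp add: theta_def)
qed

lemma y_ordinary:
  "2 \<le> r \<Longrightarrow> r \<le> n \<Longrightarrow> r \<notin> I \<Longrightarrow> r \<notin> J \<Longrightarrow> r \<notin> K \<Longrightarrow> y r = y (r - 1) + y (r - 2)"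
  using y_rec[of r] by (simp add: theta_def)

text \<open>Since \<open>y\<close> is monotone and doubles at each index of \<open>A\<close>, the
  values just before these indices, read downwards from \<open>t\<close>, are at most a half, a
  quarter, ... of \<open>y t\<close>: a geometric sum. Removing the largest index \<open>b\<close>
  leaves the same situation with \<open>b - 1\<close> for \<open>t\<close>.\<close>

lemma exceptional_halving:
  assumes "finite A" "A \<subseteq> I" "\<And>i. i \<in> A \<Longrightarrow> l < i \<and> i \<le> t" "l \<le> t" "t \<le> n"
  shows "real (y l) \<le> (1 / 2) ^ card A * real (y t) \<and>
         (\<Sum>i\<in>A. real (y (i - 1))) \<le> (1 - (1 / 2) ^ card A) * real (y t)"
  using assms
proof (induction A arbitrary: t rule: finite_linorder_max_induct)
  case empty
  then show ?case using y_mono by simp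
next
  case (insert b A)
  have b: "b \<in> I" "l < b" "b \<le> t" using insert.prems by auto
  have notin: "b \<notin> A" using insert.hyps by auto
  have "real (y l) \<le> (1 / 2) ^ card A * real (y (b - 1)) \<and>
      (\<Sum>i\<in>A. real (y (i - 1))) \<le> (1 - (1 / 2) ^ card A) * real (y (b - 1))"
    using insert.hyps insert.prems b by (intro insert.IH) fastforce+
  moreover have half: "real (y (b - 1)) \<le> real (y t) / 2"
    using y_exceptional[OF b(1)] y_mono[of b t] b insert.prems by simp
  moreover have "(1 / 2) ^ card A * real (y (b - 1)) \<le> (1 / 2) ^ card A * (real (y t) / 2)"
    using half by (rule mult_left_mono) simp
  moreover have "(1 - (1 / 2) ^ card A) * real (y (b - 1)) \<le> (1 - (1 / 2) ^ card A) * (real (y t) / 2)"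
    using half by (rule mult_left_mono) (simp add: power_le_one)
  moreover have "card (insert b A) = Suc (card A)"
    "(\<Sum>i\<in>insert b A. real (y (i - 1))) = real (y (b - 1)) + (\<Sum>i\<in>A. real (y (i - 1)))"
    using insert.hyps notin by simp_all
  ultimately show ?case
    by (simp only: power_Suc) argo
qed

section \<open>Pending steps, debt and the invariant\<close>

definition "tied r = {i \<in> I. i \<le> r \<and> r < \<pi> i}"
definition "released r = {i \<in> I. \<pi> i \<le> r \<and> r < \<psi> i}"
definition "unpaid r = {k \<in> K. \<delta> k \<le> r \<and> r < k}"

lemma finite_open [simp]: "finite (tied r)" "finite (released r)" "finite (unpaid r)"
  by (simp_all add: tied_def released_def unpaid_def)

text \<open>A penalty summand is owed only once the corresponding fine is paid; until then its index
  enters the debt only through that fine, which is counted once however many indices share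
  it.\<close>

definition debt :: "nat \<Rightarrow> real" where
  "debt r = (\<Sum>i\<in>released r. real (y (i - 1))) + (\<Sum>k\<in>unpaid r. real (y (\<delta> k - 2)))"

text \<open>
  The factors come from the worst cases: \<open>\<phi> \<cdot> (2 / \<phi>) = 2\<close> absorbs the doubling at an exceptional
  index, \<open>\<phi> / (\<phi>\<^sup>2 / 2) = 2 / \<phi>\<close> is the growth when a negligible penalty is followed by an
  ordinary step, and \<open>61 / 50\<close> is a value that leaves room both for opening and for paying a fine.
\<close>

definition bound :: "nat \<Rightarrow> real" where
  "bound r = 23 / 20 * \<phi> ^ r * (\<phi> * \<phi> / 2) ^ card (released r) * (2 / \<phi>) ^ card (tied r)
             * (61 / 50) ^ card (unpaid r)"

definition invariant :: "nat \<Rightarrow> bool" where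
  "invariant r \<longleftrightarrow> real (y r) + debt r / 2 \<le> bound r \<and>
                  real (y r) + debt r / 2 + real (y (r - 1)) \<le> \<phi> * bound r"

lemma debt_nonneg: "0 \<le> debt r"
  unfolding debt_def by (intro add_nonneg_nonneg sum_nonneg) auto

section \<open>Preservation of the invariant\<close>

lemma invariant_step:
  assumes inv: "invariant (r - 1)" and r: "2 \<le> r" "r \<le> n"
  shows "invariant r"
proof -
  define q p Y P where "q = real (y (r - 1))" and "p = real (y (r - 1 - 1))"
    and "Y = q + debt (r - 1) / 2" and "P = bound (r - 1)"
  note defs = q_def p_def Y_def P_def
  have YP: "Y \<le> P" "Y + p \<le> \<phi> * P" and qY: "q \<le> Y"
    using inv debt_nonneg[of "r - 1"] by (simp_all add: invariant_def defs)
  have nonneg: "0 \<le> q" "0 \<le> p" by (simp_all add: defs)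
  \<comment> \<open>Rational bounds turn the comparisons with \<open>\<phi> * P\<close> into linear
    arithmetic.\<close>
  have P: "1618 / 1000 * P \<le> \<phi> * P" "\<phi> * P \<le> 16181 / 10000 * P"
    using phi_gt phi_lt YP qY nonneg by (intro mult_right_mono; linarith)+
  have r': "x \<le> r - 1 \<longleftrightarrow> x < r" "r - 1 < x \<longleftrightarrow> r \<le> x" for x
    using r by auto
  \<comment> \<open>A pending set changes at \<open>r\<close> only if \<open>r\<close> is itself an
    endpoint; otherwise weak and strict comparisons agree.\<close>
  have strict:
    "i \<in> I \<Longrightarrow> r \<notin> I \<Longrightarrow> i \<le> r \<longleftrightarrow> i < r"
    "i \<in> I \<Longrightarrow> r \<notin> K \<Longrightarrow> \<pi> i \<le> r \<longleftrightarrow> \<pi> i < r"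
    "i \<in> I \<Longrightarrow> r \<notin> K \<Longrightarrow> r \<le> \<pi> i \<longleftrightarrow> r < \<pi> i"
    "i \<in> I \<Longrightarrow> r \<notin> J \<Longrightarrow> r \<le> \<psi> i \<longleftrightarrow> r < \<psi> i"
    "k \<in> K \<Longrightarrow> r \<notin> K \<Longrightarrow> r \<le> k \<longleftrightarrow> r < k"
    "k \<in> K \<Longrightarrow> r \<notin> I \<Longrightarrow> \<delta> k \<le> r \<longleftrightarrow> \<delta> k < r" for i k
    using pi_in[of i] psi_in[of i] delta(1)[of k] by (auto simp: le_less)
  have pow: "\<phi> ^ r = \<phi> * \<phi> ^ (r - 1)"
    using r by (simp flip: power_Suc)
  consider "r \<in> I" | "r \<in> J" | "r \<in> K" | "r \<notin> I" "r \<notin> J" "r \<notin> K" by blast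
  then show ?thesis
  proof cases
    case 1
    then have notin: "r \<notin> J" "r \<notin> K" using disjoint by auto
    have tied: "tied r = insert r (tied (r - 1))" and new: "r \<notin> tied (r - 1)"
      unfolding tied_def r' using 1 notin less by (auto simp: strict)
    have rel: "released r = released (r - 1)"
      unfolding released_def r' using notin by (auto simp: strict)
    have y: "real (y r) = 2 * q" using y_exceptional[OF 1] by (simp add: q_def)
    show ?thesis
    proof (cases "\<delta> (\<pi> r) = r")
      \<comment> \<open>A new fine opens and adds \<open>p\<close> to the debt. The left side is at
        most \<open>2 * Y + p / 2 \<le> (3 + \<phi>) / 2 * P\<close>, which
        \<open>61 / 25 * P\<close> covers.\<close>
      case True
      have "unpaid r = insert (\<pi> r) (unpaid (r - 1))" "\<pi> r \<notin> unpaid (r - 1)"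
        unfolding unpaid_def r' using 1 notin True less pi_in delta(2)
        by (auto simp: strict le_less)
      then have step: "debt r = debt (r - 1) + p" "bound r = 61 / 25 * P"
        using tied new rel pow phi_pos True
        by (simp_all add: debt_def bound_def defs numeral_2_eq_2)
      then show ?thesis
        unfolding invariant_def step using YP nonneg P debt_nonneg[of "r - 1"]
        unfolding y Y_def q_def[symmetric] mult.left_commute[of \<phi> _ P]
        by argo
    next
      case False
      have "unpaid r = unpaid (r - 1)"
        unfolding unpaid_def r' using notin False delta(2)
        by (auto simp: strict le_less)
      then have step: "debt r = debt (r - 1)" "bound r = 2 * P"
        using tied new rel pow phi_pos
        by (simp_all add: debt_def bound_def defs)
      then show ?thesis
        unfolding invariant_def step using YP qY nonneg P debt_nonneg[of "r - 1"]
        unfolding y Y_def q_def[symmetric] mult.left_commute[of \<phi> _ P]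
        by argo
    qed
  next
    case 2
    then obtain i where i: "i \<in> I" "r = \<psi> i"
      by (rule penalty_of)
    have other: "r \<le> \<psi> j \<longleftrightarrow> r < \<psi> j \<or> j = i" if "j \<in> I" for j
      using that i bij by (auto simp: bij_betw_def inj_on_def le_less)
    have notin: "r \<notin> I" "r \<notin> K" using 2 disjoint by auto
    have before: "\<pi> i < r" "\<not> r < \<psi> i" using less[OF i(1)] i(2) by simp_all
    have tied: "tied r = tied (r - 1)"
      unfolding tied_def r' using notin by (auto simp: strict)
    have unp: "unpaid r = unpaid (r - 1)"
      unfolding unpaid_def r' using notin by (auto simp: strict)
    have rel: "released (r - 1) = insert i (released r)" "i \<notin> released r"
      unfolding released_def r' using notin i(1) before by (auto simp: strict other)
    define c where "c = real (y (i - 1))"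
    have y: "real (y r) = q + c" using y_penalty[OF i(1)] i by (simp add: c_def q_def)
    have debt: "debt (r - 1) = debt r + c"
      using rel tied unp by (simp add: debt_def c_def)
    have "\<phi> * P = \<phi> * \<phi> / 2 * (\<phi> * bound r) / \<phi> "
      using rel tied unp pow by (simp add: bound_def P_def)
    then have "bound r = 2 * (P / \<phi>)"
      using phi_pos by (simp add: field_simps)
    moreover have "P / \<phi> = \<phi> * P - P" using phi_pos phi_sq by (simp add: field_simps)
    ultimately have bound: "bound r = 2 * (\<phi> * P - P)" by simp
    then have bound': "\<phi> * bound r = 2 * P"
      using phi_mult_left[of P] by (simp add: right_diff_distrib mult.left_commute[of \<phi> 2])
    \<comment> \<open>Half of \<open>c\<close> was already in \<open>Y\<close>, so the left side
      rises only by \<open>c / 2\<close>. As \<open>y\<close> doubled at \<open>i\<close>,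
      \<open>2 * c \<le> q\<close>, hence \<open>c / 2 \<le> Y / 5\<close>, while
      \<open>bound r \<ge> 6 / 5 * P\<close>; the second inequality follows from
      \<open>q + c / 2 \<le> Y\<close>.\<close>
    have "i \<le> r - 1" "r - 1 \<le> n" using before less(1)[OF i(1)] r by linarith+
    then have "2 * c \<le> q"
      using y_exceptional[OF i(1)] y_mono[of i "r - 1"] by (simp add: c_def q_def)
    moreover have "0 \<le> c" by (simp add: c_def)
    ultimately show ?thesis
      unfolding invariant_def bound' unfolding bound y q_def[symmetric]
      using YP(1) P debt debt_nonneg[of r] unfolding Y_def by argo
  next
    case 3
    define G where "G = {i \<in> I. \<pi> i = r}"
    define f S where "f = real (y (\<delta> r - 2))" and "S = (\<Sum>i\<in>G. real (y (i - 1)))"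
    have notin: "r \<notin> I" "r \<notin> J" using 3 disjoint by auto
    have G: "finite G" "G \<subseteq> I" "\<delta> r \<in> G"
      using delta[OF 3] by (auto simp: G_def)
    have tied: "tied (r - 1) = tied r \<union> G" "tied r \<inter> G = {}"
      unfolding tied_def G_def r' using notin less by (auto simp: strict le_less)
    have rel: "released r = released (r - 1) \<union> G" "released (r - 1) \<inter> G = {}"
      unfolding released_def G_def r' using notin less by (auto simp: strict le_less[of _ r])
    have unp: "unpaid (r - 1) = insert r (unpaid r)" "r \<notin> unpaid r"
      unfolding unpaid_def r' using notin 3 delta[OF 3] less by (fastforce simp: strict)+
    have debt: "debt (r - 1) + S = debt r + f"
      using rel unp G by (simp add: debt_def f_def S_def sum.union_disjoint)
    have y: "real (y r) = q + f" using y_fine[OF 3] by (simp add: f_def q_def)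
    have "f \<le> (1 / 2) ^ card G * q \<and> S \<le> (1 - (1 / 2) ^ card G) * q"
      unfolding f_def S_def q_def
    \<comment> \<open>\<open>\<delta> r\<close> is the least element of \<open>G\<close>, so all
      doublings in \<open>G\<close> happen between \<open>\<delta> r - 2\<close> and
      \<open>r - 1\<close>.\<close>
    proof (rule exceptional_halving)
      show "\<delta> r - 2 < i \<and> i \<le> r - 1" if "i \<in> G" for i
        using that delta_le[of i] less[of i] subsets by (force simp: G_def)
      show "\<delta> r - 2 \<le> r - 1"
        using less[of "\<delta> r"] delta[OF 3] by simp
    qed (use G r in auto)
    moreover have "f \<le> debt (r - 1)"
      unfolding debt_def f_def unp(1) using unp(2)
      by (simp add: sum_nonneg add_nonneg_nonneg)
    moreover have "card G > 0" using G by (auto simp: card_gt_0_iff)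
    ultimately have step: "Y + f / 2 + S / 2 \<le> 50 / 61 * \<phi> * (\<phi> ^ 3 / 4) ^ card G * P"
      "Y + f / 2 + S / 2 + q \<le> \<phi> * (50 / 61 * \<phi> * (\<phi> ^ 3 / 4) ^ card G * P)"
      using YP fine_step_bound[of f "card G" q S Y P] by (simp_all add: f_def Y_def)
    have bound: "bound r = 50 / 61 * \<phi> * (\<phi> ^ 3 / 4) ^ card G * P"
    proof -
      have "\<phi> * \<phi> / 2 = (\<phi> ^ 3 / 4) * (2 / \<phi>)"
        using phi_pos by (simp add: power3_eq_cube)
      then have "(\<phi> * \<phi> / 2) ^ card G = (\<phi> ^ 3 / 4) ^ card G * (2 / \<phi>) ^ card G"
        by (simp only: power_mult_distrib)
      then show ?thesis
        using rel tied unp pow G by (simp add: bound_def P_def card_Un_disjoint power_add)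
    qed
    show ?thesis
      unfolding invariant_def y q_def[symmetric]
      using step[folded bound] debt unfolding Y_def by argo
  next
    case 4
    have "tied r = tied (r - 1)" "released r = released (r - 1)" "unpaid r = unpaid (r - 1)"
      unfolding tied_def released_def unpaid_def r' using 4 by (auto simp: strict)
    then have "debt r = debt (r - 1)" "bound r = \<phi> * P"
      using pow by (simp_all add: debt_def bound_def defs)
    moreover have "real (y r) = q + p"
      using y_ordinary[OF r 4] by (simp add: defs numeral_2_eq_2)
    \<comment> \<open>The old second inequality is the new first one; adding
      \<open>q \<le> P\<close> to it gives the new second one, by
      \<open>\<phi> * \<phi> = \<phi> + 1\<close>.\<close>
    ultimately show ?thesis
      using YP debt_nonneg[of "r - 1"] nonneg by (simp add: invariant_def defs phi_mult_left)
  qed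
qed

section \<open>Start of the invariant and conclusion\<close>

text \<open>Fines and penalties come after their exceptional indices, so before the first of these
  every step is ordinary.\<close>

lemma y_eq_F:
  "t \<le> n \<Longrightarrow> (\<And>i. i \<in> I \<Longrightarrow> t < i) \<Longrightarrow> y t = F (t + 1)"
proof (induction t rule: fib.induct)
  case 1
  then show ?case using y_0 by (simp add: F_def)
next
  case 2
  then show ?case using y_1 by (simp add: F_def eval_nat_numeral)
next
  case (3 t)
  have I: "Suc (Suc t) < i" if "i \<in> I" for i using 3 that by blast
  have K: "Suc (Suc t) < k" if "k \<in> K" for k
    using I[of "\<delta> k"] delta[OF that] less[of "\<delta> k"] by simp
  have J: "Suc (Suc t) < j" if "j \<in> J" for j
  proof -
    obtain i where "i \<in> I" "j = \<psi> i" using \<open>j \<in> J\<close> by (rule penalty_of)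
    then show ?thesis using I[of i] less[of i] by simp
  qed
  have "y (Suc (Suc t)) = y (Suc t) + y t"
    using y_ordinary[of "Suc (Suc t)"] I[of "Suc (Suc t)"] J[of "Suc (Suc t)"] K[of "Suc (Suc t)"]
      3 by auto
  moreover have "y (Suc t) = F (Suc t + 1)" "y t = F (t + 1)"
    using 3 I by (fastforce intro: "3.IH")+
  ultimately show ?case by (simp add: F_def)
qed

text \<open>On an ordinary initial stretch \<open>y r = F (r + 1)\<close> is above
  \<open>23/20 * \<phi> ^ r\<close> from \<open>r = 4\<close> on, so the invariant cannot start
  earlier in general; at \<open>Min I\<close> the factors of one tied index and one unpaid fine make
  room.\<close>

lemma invariant_start:
  assumes "I \<noteq> {}"
  shows "invariant (Min I)"
proof -
  define a where "a = Min I"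
  have min: "a \<le> i" if "i \<in> I" for i
    using that by (simp add: a_def)
  have a: "a \<in> I" using assms by (simp add: a_def)
  obtain m where m: "a = m + 2"
    using a subsets by (metis add.commute atLeastAtMost_iff le_Suc_ex subsetD)
  have n: "a \<le> n" using a subsets by auto
  have delta_a: "\<delta> (\<pi> a) = a"
    using delta_le[OF a] min[OF delta(1)[OF pi_in[OF a]]] by simp
  have "tied a = {a}" "released a = {}"
    using a min less by (fastforce simp: tied_def released_def)+
  moreover have "unpaid a = {\<pi> a}"
  proof -
    have "k = \<pi> a" if "k \<in> K" "\<delta> k \<le> a" for k
      using that min[OF delta(1)] delta(2) by (metis le_antisym)
    then show ?thesis using a delta_a pi_in less by (auto simp: unpaid_def)
  qed
  ultimately have start: "debt a = real (y m)" "bound a = 1403 / 500 * \<phi> ^ (m + 1)"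
    using delta_a m phi_pos by (simp_all add: debt_def bound_def)
  have "y m = F (m + 1)" "y (a - 1) = F (m + 2)"
    using y_eq_F[of m] y_eq_F[of "m + 1"] n min m by fastforce+
  then show ?thesis
    unfolding invariant_def a_def[symmetric] start
    using F_le_phi_power[of m] y_exceptional[OF a] m by simp
qed

lemma y_le_F: "y n \<le> F (n + 1)"
proof (cases "I = {}")
  case True
  then show ?thesis using y_eq_F[of n] by simp
next
  case False
  then have a: "Min I \<in> I" by simp
  \<comment> \<open>A fine and a penalty follow \<open>Min I\<close>, so \<open>n \<ge> 4\<close>,
    as \<open>phi_power_le_F\<close> requires.\<close>
  then have bounds: "2 \<le> Min I" "Min I + 2 \<le> n"
    using subsets less[OF a] psi_in[OF a] by fastforce+
  have "Min I \<le> r \<Longrightarrow> r \<le> n \<Longrightarrow> invariant r" for r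
  proof (induction r rule: dec_induct)
    case base
    then show ?case using invariant_start[OF False] by simp
  next
    case (step r)
    then show ?case using invariant_step[of "Suc r"] bounds by simp
  qed
  then have inv: "invariant n" using bounds by simp
  \<comment> \<open>All fines and penalties are at most \<open>n\<close>, so nothing is
    pending.\<close>
  have "tied n = {}" "released n = {}" "unpaid n = {}"
    using subsets pi_in psi_in by (fastforce simp: tied_def released_def unpaid_def)+
  then have "real (y n) \<le> 23 / 20 * \<phi> ^ n"
    using inv by (simp add: invariant_def debt_def bound_def)
  also have "\<dots> \<le> real (F (n + 1))"
    using phi_power_le_F[of "n - 4"] bounds by simp
  finally show ?thesis by simp
qed

end

theorem theorem4p15:
  fixes n :: nat and I J K :: "nat set" and \<psi> \<pi> y :: "nat \<Rightarrow> nat"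
  assumes "is_system n I J K \<psi> \<pi>"
    and "is_generated_by y n I J K \<psi> \<pi>"
  shows "y n \<le> F (n + 1)"
proof -
  interpret generated_system n I J K \<psi> \<pi> y
    using assms by unfold_locales
  show ?thesis by (rule y_le_F)
qed

end
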